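(* Let $\mathbf w\in\Xi_R$ be a regular design and let $u,v\in\mathfrak X$ be design points such that at least one of the weights $w_u,w_v$ is strictly positive. Let $I=(-w_v,w_u)$, $\bar I=[-w_v,w_u]$, let $A,B,C,D$ be the constants and $\bar h:\bar I\to\mathbb R\cup\{-\infty\}$ the function defined in the context. If $AD=-BC$ and $B\ne0$, let $\alpha^*_s=-\frac{A}{2B}$; and if $AD\neq -BC$, let $$\alpha^*_s=-\frac{B+\sqrt{B^2-A(AD+BC)}}{AD+BC}.$$ (1) If $\alpha^*_s$ is so defined and $\alpha^*_s\in I$, then $\alpha^*_s$ maximizes $\bar h$ on $\bar I$. (2) If $AD=-BC$ and $B=0$, or if $\alpha^*_s\notin I$, let $$\alpha^*_n=\begin{cases} w_u & \text{if } A>0,\\ 0 & \text{if } A=0,\\ -w_v & \text{if } A<0.\end{cases}$$ Then $\alpha^*_n$ maximizes $\bar h$ on $\bar I$.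
   Context: Let $\mathfrak X=\{1,\dots,n\}$ and let $\mathbf f(1),\dots,\mathbf f(n)\in\mathbb R^m$ be non-zero vectors spanning $\mathbb R^m$. $\Xi=\{\mathbf w\in\mathbb R^n: w_x\ge 0\ \forall x,\ \sum_x w_x=1\}$ is the set of designs; $\mathbf M(\mathbf w)=\sum_{x\in\mathfrak X}w_x\mathbf f(x)\mathbf f(x)'$ (prime denotes transpose); $\Xi_R=\{\mathbf w\in\Xi:\mathbf M(\mathbf w)\text{ is non-singular}\}$. For the fixed $\mathbf w\in\Xi_R$ and $u,v$, write $\mathbf f_u=\mathbf f(u)$, $\mathbf f_v=\mathbf f(v)$, $\mathbf M=\mathbf M(\mathbf w)$, $\mathbf V=\mathbf M^{-1}$, and $$d_u=\mathbf f_u'\mathbf V\mathbf f_u,\quad d_v=\mathbf f_v'\mathbf V\mathbf f_v,\quad d_{uv}=\mathbf f_u'\mathbf V\mathbf f_v,\quad a_u=\mathbf f_u'\mathbf V^2\mathbf f_u,\quad a_v=\mathbf f_v'\mathbf V^2\mathbf f_v,\quad a_{uv}=\mathbf f_u'\mathbf V^2\mathbf f_v,$$ $$A=a_v-a_u,\quad B=2d_{uv}a_{uv}-d_ua_v-d_va_u,\quad C=d_v-d_u,\quad D=d_ud_v-d_{uv}^2.$$ For $\alpha\in I=(-w_v,w_u)$ the matrix $\mathbf M_\alpha=\mathbf M+\alpha\mathbf f_v\mathbf f_v'-\alpha\mathbf f_u\mathbf f_u'$ is positive definite, and $h:I\to\mathbb R$ is defined by $$h(\alpha)=-\operatorname{tr}(\mathbf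 M_\alpha^{-1})=-\operatorname{tr}(\mathbf V)+\frac{\alpha A+\alpha^2B}{1+\alpha C-\alpha^2D}.$$ $\bar h:\bar I\to\mathbb R\cup\{-\infty\}$ denotes the continuous extension of $h$ to $\bar I=[-w_v,w_u]$. (The quantity under the square root in the claim is always non-negative.) *)

theory Defs
  imports "HOL-Analysis.Analysis"
begin

(* The type of row indices of rowvector and of column indices of columnvector is
   unconstrained; it has to be pinned to the one-element type 1 to get y y'. *)
definition outer :: "real^'m \<Rightarrow> real^'m^'m" where
  "outer y = (columnvector y :: real^1^'m) ** (rowvector y :: real^'m^1)"

definition designs :: "(real^'n::finite) set" where
  "designs = {w. (\<forall>x. 0 \<le> w $ x) \<and> (\<Sum>x\<in>UNIV. w $ x) = 1}"

definition info_matrix :: "('n::finite \<Rightarrow> real^'m) \<Rightarrow> real^'n \<Rightarrow> real^'m^'m" where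
  "info_matrix f w = (\<Sum>x\<in>UNIV. w $ x *\<^sub>R outer (f x))"

definition regular_designs :: "('n::finite \<Rightarrow> real^'m) \<Rightarrow> (real^'n) set" where
  "regular_designs f = {w \<in> designs. invertible (info_matrix f w)}"

definition var_matrix :: "('n::finite \<Rightarrow> real^'m) \<Rightarrow> real^'n \<Rightarrow> real^'m^'m" where
  "var_matrix f w = matrix_inv (info_matrix f w)"

(* d_xy = f_x' V f_y and a_xy = f_x' V^2 f_y; d_x and a_x are the case x = y. *)
definition d_cov :: "('n::finite \<Rightarrow> real^'m) \<Rightarrow> real^'n \<Rightarrow> 'n \<Rightarrow> 'n \<Rightarrow> real" where
  "d_cov f w x y = f x \<bullet> (var_matrix f w *v f y)"

definition a_cov :: "('n::finite \<Rightarrow> real^'m) \<Rightarrow> real^'n \<Rightarrow> 'n \<Rightarrow> 'n \<Rightarrow> real" where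
  "a_cov f w x y = f x \<bullet> ((var_matrix f w ** var_matrix f w) *v f y)"

definition coef_A :: "('n::finite \<Rightarrow> real^'m) \<Rightarrow> real^'n \<Rightarrow> 'n \<Rightarrow> 'n \<Rightarrow> real" where
  "coef_A f w u v = a_cov f w v v - a_cov f w u u"

definition coef_B :: "('n::finite \<Rightarrow> real^'m) \<Rightarrow> real^'n \<Rightarrow> 'n \<Rightarrow> 'n \<Rightarrow> real" where
  "coef_B f w u v = 2 * d_cov f w u v * a_cov f w u v
     - d_cov f w u u * a_cov f w v v - d_cov f w v v * a_cov f w u u"

definition coef_C :: "('n::finite \<Rightarrow> real^'m) \<Rightarrow> real^'n \<Rightarrow> 'n \<Rightarrow> 'n \<Rightarrow> real" where
  "coef_C f w u v = d_cov f w v v - d_cov f w u u"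

definition coef_D :: "('n::finite \<Rightarrow> real^'m) \<Rightarrow> real^'n \<Rightarrow> 'n \<Rightarrow> 'n \<Rightarrow> real" where
  "coef_D f w u v = d_cov f w u u * d_cov f w v v - (d_cov f w u v)\<^sup>2"

definition M_shift :: "('n::finite \<Rightarrow> real^'m) \<Rightarrow> real^'n \<Rightarrow> 'n \<Rightarrow> 'n \<Rightarrow> real \<Rightarrow> real^'m^'m" where
  "M_shift f w u v \<alpha> = info_matrix f w + \<alpha> *\<^sub>R outer (f v) - \<alpha> *\<^sub>R outer (f u)"

definition h_crit :: "('n::finite \<Rightarrow> real^'m) \<Rightarrow> real^'n \<Rightarrow> 'n \<Rightarrow> 'n \<Rightarrow> real \<Rightarrow> real" where
  "h_crit f w u v \<alpha> = - trace (matrix_inv (M_shift f w u v \<alpha>))"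

(* The continuous extension of h_crit from the open interval (-w_v, w_u) to its closure, with
   value -\<infinity> where h_crit diverges. At an endpoint only the limit from inside is used,
   since h_crit itself is meaningless there if the shifted matrix is singular. *)
definition hbar :: "('n::finite \<Rightarrow> real^'m) \<Rightarrow> real^'n \<Rightarrow> 'n \<Rightarrow> 'n \<Rightarrow> real \<Rightarrow> ereal" where
  "hbar f w u v \<alpha> = Lim (at \<alpha> within {- (w $ v)<..<w $ u}) (\<lambda>\<beta>. ereal (h_crit f w u v \<beta>))"

lemma hbar_is_the_continuous_extension:
  fixes g :: "real \<Rightarrow> ereal"
  assumes "- (w $ v) < w $ u"
    and cont: "continuous_on {- (w $ v)..w $ u} g"
    and agree: "\<And>\<beta>. \<beta> \<in> {- (w $ v)<..<w $ u} \<Longrightarrow> g \<beta> = ereal (h_crit f w u v \<beta>)"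
    and \<alpha>: "\<alpha> \<in> {- (w $ v)..w $ u}"
  shows "hbar f w u v \<alpha> = g \<alpha>"
proof -
  let ?I = "{- (w $ v)<..<w $ u}"
  have "(g \<longlongrightarrow> g \<alpha>) (at \<alpha> within {- (w $ v)..w $ u})"
    using cont \<alpha> by (simp add: continuous_on_def)
  then have "(g \<longlongrightarrow> g \<alpha>) (at \<alpha> within ?I)"
    by (rule tendsto_within_subset) auto
  moreover have "eventually (\<lambda>\<beta>. g \<beta> = ereal (h_crit f w u v \<beta>)) (at \<alpha> within ?I)"
    by (auto simp: eventually_at_filter agree)
  ultimately have lim: "((\<lambda>\<beta>. ereal (h_crit f w u v \<beta>)) \<longlongrightarrow> g \<alpha>) (at \<alpha> within ?I)"
    by (rule Lim_transform_eventually)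
  have "closure ?I = {- (w $ v)..w $ u}"
    using assms(1) by (rule closure_greaterThanLessThan)
  then have "\<alpha> \<in> closure ?I"
    using \<alpha> by simp
  then have "\<alpha> islimpt ?I"
    using open_greaterThanLessThan interior_limit_point[of \<alpha> ?I]
    by (auto simp: closure_def interior_open)
  then have "\<not> trivial_limit (at \<alpha> within ?I)"
    by (simp add: trivial_limit_within)
  then show ?thesis
    unfolding hbar_def using lim by (rule tendsto_Lim)
qed

(* The stationary point is undefined exactly if A D = - B C and B = 0. *)
definition stationary :: "real \<Rightarrow> real \<Rightarrow> real \<Rightarrow> real \<Rightarrow> real option" where
  "stationary A B C D =
     (if A * D = - (B * C)
      then if B \<noteq> 0 then Some (- A / (2 * B)) else None
      else Some (- (B + sqrt (B\<^sup>2 - A * (A * D + B * C))) / (A * D + B * C)))"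

definition alpha_s :: "('n::finite \<Rightarrow> real^'m) \<Rightarrow> real^'n \<Rightarrow> 'n \<Rightarrow> 'n \<Rightarrow> real option" where
  "alpha_s f w u v =
     stationary (coef_A f w u v) (coef_B f w u v) (coef_C f w u v) (coef_D f w u v)"

definition alpha_n :: "('n::finite \<Rightarrow> real^'m) \<Rightarrow> real^'n \<Rightarrow> 'n \<Rightarrow> 'n \<Rightarrow> real" where
  "alpha_n f w u v =
     (if coef_A f w u v > 0 then w $ u else if coef_A f w u v = 0 then 0 else - (w $ v))"

end

theory Submission
  imports Defs
begin

text \<open>
  By Woodbury's identity the criterion is a constant plus the quotient of
  \<open>N = \<alpha> A + \<alpha>\<^sup>2 B\<close> and \<open>\<Delta> = 1 + \<alpha> C - \<alpha>\<^sup>2 D\<close>, so its derivative is \<open>q / \<Delta>\<^sup>2\<close> with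
  \<open>q = A + 2 B \<alpha> + E \<alpha>\<^sup>2\<close> and \<open>E = A D + B C\<close>. Cauchy-Schwarz for the Gram matrices of the
  \<open>d\<close> and the \<open>a\<close> gives \<open>B \<le> 0\<close>, \<open>D \<ge> 0\<close> and a nonnegative discriminant of \<open>q\<close>; from then
  on everything is algebra of rational functions, and no concavity argument is needed.
  The chosen root \<open>s\<close> of \<open>q\<close> has \<open>B + E s \<le> 0\<close>, and
  \<open>N(s) \<Delta>(\<beta>) - N(\<beta>) \<Delta>(s) = - (s - \<beta>)\<^sup>2 (B + E s)\<close>, so \<open>s\<close> is a global maximum wherever
  \<open>\<Delta>\<close> is positive. If \<open>s\<close> lies outside the interval and \<open>A > 0\<close>, then \<open>q > 0\<close> on the
  interval, because the other root of \<open>q\<close> is either beyond \<open>s\<close> or separated from \<open>0\<close> by a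
  zero of \<open>\<Delta>\<close>; the case \<open>A < 0\<close> follows by reflection. At an end point where \<open>\<Delta>\<close> vanishes,
  \<open>N\<close> is negative, so the continuous extension is \<open>-\<infinity>\<close> there.
\<close>

section \<open>Algebra of the rational criterion and its stationary point\<close>

definition den :: "real \<Rightarrow> real \<Rightarrow> real \<Rightarrow> real" where
  "den C D \<alpha> = 1 + \<alpha> * C - \<alpha>\<^sup>2 * D"

definition num :: "real \<Rightarrow> real \<Rightarrow> real \<Rightarrow> real" where
  "num A B \<alpha> = \<alpha> * A + \<alpha>\<^sup>2 * B"

text \<open>The value \<open>-\<infinity>\<close> at a zero of \<open>den\<close> is the correct
  limit on the closed interval because \<open>den\<close> is nonnegative and \<open>num\<close> is
  negative there (\<open>num_neg\<close>).\<close>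

definition crit_ext :: "real \<Rightarrow> real \<Rightarrow> real \<Rightarrow> real \<Rightarrow> real \<Rightarrow> real \<Rightarrow> ereal" where
  "crit_ext c A B C D \<alpha> =
     (if den C D \<alpha> = 0 then -\<infinity> else ereal (c + num A B \<alpha> / den C D \<alpha>))"

text \<open>The difference vanishes for \<open>s = \<beta>\<close>, so \<open>s - \<beta>\<close>
  splits off; on the diagonal the cofactor is the numerator of the derivative.\<close>

lemma num_den_cross:
  "num A B s * den C D \<beta> - num A B \<beta> * den C D s =
     (s - \<beta>) * (A + B * (s + \<beta>) + (A * D + B * C) * s * \<beta>)"
  unfolding num_def den_def by algebra

text \<open>The sign chosen for the square root makes \<open>B + E * s\<close> equal to
  \<open>- t\<close>; in the linear case it is \<open>B\<close> itself.\<close>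

lemma stationary_root:
  assumes "B \<le> 0" and disc: "0 \<le> B\<^sup>2 - A * (A * D + B * C)"
    and s: "stationary A B C D = Some s"
  shows "A + 2 * B * s + (A * D + B * C) * s\<^sup>2 = 0" and "B + (A * D + B * C) * s \<le> 0"
proof -
  define E where "E = A * D + B * C"
  have "A + 2 * B * s + E * s\<^sup>2 = 0 \<and> B + E * s \<le> 0"
  proof (cases "E = 0")
    case True
    then have "s = - A / (2 * B)" "B \<noteq> 0"
      using s by (auto simp: stationary_def E_def split: if_splits)
    then show ?thesis using True \<open>B \<le> 0\<close> by simp
  next
    case False
    define t where "t = sqrt (B\<^sup>2 - A * E)"
    have t: "t \<ge> 0" "t\<^sup>2 = B\<^sup>2 - A * E"
      using disc by (simp_all add: t_def E_def)
    have "s = - (B + t) / E"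
      using s False by (auto simp: stationary_def E_def t_def split: if_splits)
    then have Es: "E * s = - (B + t)" using False by simp
    \<comment> \<open>Multiplication by \<open>E\<close> gives
      \<open>(E * s + B)\<^sup>2 - t\<^sup>2\<close>, so no division by \<open>E\<close>
      remains.\<close>
    have "E * (A + 2 * B * s + E * s\<^sup>2) = A * E + 2 * B * (E * s) + (E * s)\<^sup>2"
      by algebra
    also have "\<dots> = 0" unfolding Es using t(2) by algebra
    finally show ?thesis using Es t(1) False by simp
  qed
  then show "A + 2 * B * s + (A * D + B * C) * s\<^sup>2 = 0" "B + (A * D + B * C) * s \<le> 0"
    by (auto simp: E_def)
qed

lemma crit_ext_le_stationary:
  assumes "B \<le> 0" and "0 \<le> B\<^sup>2 - A * (A * D + B * C)"
    and "stationary A B C D = Some s"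
    and s: "den C D s > 0" and \<beta>: "den C D \<beta> \<ge> 0"
  shows "crit_ext c A B C D \<beta> \<le> crit_ext c A B C D s"
proof (cases "den C D \<beta> = 0")
  case True
  then show ?thesis by (simp add: crit_ext_def)
next
  case False
  note root = stationary_root[OF assms(1-3)]
  \<comment> \<open>The root equation eliminates \<open>A\<close> from the cofactor in
    \<open>num_den_cross\<close>, which then contains a second factor
    \<open>s - \<beta>\<close>.\<close>
  have "num A B s * den C D \<beta> - num A B \<beta> * den C D s = (s - \<beta>)\<^sup>2 * - (B + (A * D + B * C) * s)"
    unfolding num_den_cross using root(1) by algebra
  also have "\<dots> \<ge> 0" using root(2) by (intro mult_nonneg_nonneg) auto
  finally have "num A B \<beta> / den C D \<beta> \<le> num A B s / den C D s"
    using False \<beta> s by (simp add: frac_le_eq divide_le_0_iff field_simps)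
  then show ?thesis
    using False s by (simp add: crit_ext_def)
qed

text \<open>Reflecting \<open>\<alpha>\<close> amounts to exchanging the two design points:
  \<open>A\<close>, \<open>C\<close> and hence \<open>E\<close> change sign, while \<open>B\<close>,
  \<open>D\<close> and the discriminant do not.\<close>

lemma stationary_uminus:
  "stationary (- A) B (- C) D = map_option uminus (stationary A B C D)"
  by (auto simp: stationary_def divide_simps) (auto simp: algebra_simps)

lemma crit_ext_uminus: "crit_ext c (- A) B (- C) D (- \<alpha>) = crit_ext c A B C D \<alpha>"
  by (simp add: crit_ext_def num_def den_def)

text \<open>The quadratic is the numerator of the derivative of the criterion.\<close>

lemma slope_pos:
  assumes A: "A > 0" and B: "B \<le> 0" and D: "D \<ge> 0"
    and disc: "0 \<le> B\<^sup>2 - A * (A * D + B * C)"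
    and stat: "\<And>s. stationary A B C D = Some s \<Longrightarrow> s \<notin> {l<..<r}"
    and I: "l \<le> 0" "\<alpha> \<in> {l<..<r}" and den: "den C D \<alpha> > 0"
  shows "A + 2 * B * \<alpha> + (A * D + B * C) * \<alpha>\<^sup>2 > 0"
proof (cases "\<alpha> \<le> 0")
  case True
  then have Ba: "B * \<alpha> \<ge> 0" using B by (simp add: mult_nonpos_nonpos)
  show ?thesis
  proof (cases "C - 2 * \<alpha> * D \<ge> 0")
    case True
    \<comment> \<open>This is the quotient rule \<open>N' * \<Delta> - N * \<Delta>'\<close> with
      \<open>N = \<alpha> * (A + B * \<alpha>)\<close> and
      \<open>\<Delta>' = C - 2 * \<alpha> * D\<close>. Here \<open>N\<close> is nonpositive and
      \<open>\<Delta>'\<close> nonnegative.\<close>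
    have "A + 2 * B * \<alpha> + (A * D + B * C) * \<alpha>\<^sup>2 =
      (A + 2 * (B * \<alpha>)) * den C D \<alpha> + (- \<alpha>) * (A + B * \<alpha>) * (C - 2 * \<alpha> * D)"
      unfolding den_def by algebra
    moreover have "(A + 2 * (B * \<alpha>)) * den C D \<alpha> > 0"
      using A Ba den by (intro mult_pos_pos) auto
    moreover have "(- \<alpha>) * (A + B * \<alpha>) * (C - 2 * \<alpha> * D) \<ge> 0"
      using A Ba True \<open>\<alpha> \<le> 0\<close> by (intro mult_nonneg_nonneg) auto
    ultimately show ?thesis by linarith
  next
    case False
    have "\<alpha> * D \<le> 0" using \<open>\<alpha> \<le> 0\<close> D by (simp add: mult_nonpos_nonneg)
    \<comment> \<open>Once \<open>C\<close> is nonpositive, so is no summand of the quadratic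
      negative: \<open>A * D\<close> and \<open>B * C\<close> are both nonnegative.\<close>
    with False have "C \<le> 0" by linarith
    then have "B * C \<ge> 0" using B by (simp add: mult_nonpos_nonpos)
    then have "(A * D + B * C) * \<alpha>\<^sup>2 \<ge> 0" using A D by simp
    then show ?thesis using A Ba by simp
  qed
next
  case False
  then have \<alpha>: "\<alpha> > 0" by simp
  \<comment> \<open>A positive stationary point exceeds \<open>l\<close>, so it can lie outside the
    interval only on the right.\<close>
  have beyond: "\<alpha> < s" if "stationary A B C D = Some s" "s > 0" for s
    using stat[OF that(1)] that(2) I by auto
  define E where "E = A * D + B * C"
  have "A + 2 * B * \<alpha> + E * \<alpha>\<^sup>2 > 0"
  proof (cases "E = 0")
    case E: True
    show ?thesis
    proof (cases "B = 0")
      case True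
      then show ?thesis using A E by simp
    next
      case False
      then have "B < 0" using B by simp
      have "stationary A B C D = Some (- A / (2 * B))"
        using E False by (simp add: stationary_def E_def add_eq_0_iff)
      moreover have "- A / (2 * B) > 0"
        using A \<open>B < 0\<close> by (intro divide_neg_neg) auto
      ultimately have "\<alpha> < - A / (2 * B)" by (rule beyond)
      then show ?thesis using E \<open>B < 0\<close> by (simp add: field_simps)
    qed
  next
    case E: False
    define t where "t = sqrt (B\<^sup>2 - A * E)"
    have t: "t \<ge> 0" "t\<^sup>2 = B\<^sup>2 - A * E"
      using disc by (simp_all add: t_def E_def)
    define s where "s = - (B + t) / E"
    have Es: "E * s = - (B + t)" using E by (simp add: s_def)
    have "stationary A B C D = Some s"
      using E by (auto simp: stationary_def E_def t_def s_def add_eq_0_iff)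
    note s_beyond = beyond[OF this]
    \<comment> \<open>Completing the square; the first factor is \<open>E * (\<alpha> - s)\<close>,
      the second belongs to the other root.\<close>
    have fact: "E * (A + 2 * B * \<alpha> + E * \<alpha>\<^sup>2) = (E * \<alpha> + B + t) * (E * \<alpha> + B - t)"
      using t(2) by algebra
    show ?thesis
    proof (cases "E > 0")
      case True
      \<comment> \<open>For \<open>E > 0\<close> both roots are positive and \<open>s\<close> is the
        smaller one, so \<open>\<alpha>\<close> lies to the left of both.\<close>
      have "t\<^sup>2 < (- B)\<^sup>2" using t(2) A True by simp
      then have tB: "t < - B" using B by (intro power_less_imp_less_base[of t 2]) auto
      then have "s > 0" using True by (simp add: s_def divide_neg_pos)
      then have "\<alpha> < s" by (rule s_beyond)
      then have "E * \<alpha> < E * s" using True by simp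
      then have "E * \<alpha> + B + t < 0" using Es by simp
      moreover from this have "E * \<alpha> + B - t < 0" using t(1) by simp
      ultimately have "E * (A + 2 * B * \<alpha> + E * \<alpha>\<^sup>2) > 0"
        unfolding fact by (rule mult_neg_neg)
      then show ?thesis using True by (simp add: zero_less_mult_iff)
    next
      case False
      then have "E < 0" using E by simp
      \<comment> \<open>For \<open>E < 0\<close> the roots have opposite signs and \<open>s\<close>
        is the positive one, so \<open>\<alpha>\<close> lies between them.\<close>
      have "A * E < 0" using A \<open>E < 0\<close> by (simp add: mult_pos_neg)
      then have "(- B)\<^sup>2 < t\<^sup>2" using t(2) by simp
      then have tB: "- B < t" using t(1) by (rule power_less_imp_less_base)
      then have "s > 0" using \<open>E < 0\<close> by (simp add: s_def divide_neg_neg)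
      then have "\<alpha> < s" by (rule s_beyond)
      then have "E * \<alpha> > E * s" using \<open>E < 0\<close> by simp
      then have "E * \<alpha> + B + t > 0" using Es by simp
      moreover have "E * \<alpha> < 0" using \<open>E < 0\<close> \<alpha> by (simp add: mult_neg_pos)
      then have "E * \<alpha> + B - t < 0" using B t(1) by simp
      ultimately have "E * (A + 2 * B * \<alpha> + E * \<alpha>\<^sup>2) < 0"
        unfolding fact by (rule mult_pos_neg)
      then show ?thesis using \<open>E < 0\<close> by (simp add: mult_less_0_iff)
    qed
  qed
  then show ?thesis by (simp add: E_def)
qed

section \<open>Continuity of the extension and maxima at the end points or at zero\<close>

lemma continuous_on_crit_ext:
  assumes nonneg: "\<And>\<alpha>. \<alpha> \<in> S \<Longrightarrow> den C D \<alpha> \<ge> 0"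
    and neg: "\<And>\<alpha>. \<alpha> \<in> S \<Longrightarrow> den C D \<alpha> = 0 \<Longrightarrow> num A B \<alpha> < 0"
  shows "continuous_on S (crit_ext c A B C D)"
  unfolding continuous_on_def
proof
  fix \<alpha> assume \<alpha>: "\<alpha> \<in> S"
  have den_lim: "(den C D \<longlongrightarrow> den C D \<alpha>) (at \<alpha> within S)"
    unfolding den_def by (intro tendsto_intros)
  have num_lim: "(num A B \<longlongrightarrow> num A B \<alpha>) (at \<alpha> within S)"
    unfolding num_def by (intro tendsto_intros)
  have in_S: "eventually (\<lambda>\<beta>. \<beta> \<in> S) (at \<alpha> within S)"
    by (simp add: eventually_at_filter)
  show "(crit_ext c A B C D \<longlongrightarrow> crit_ext c A B C D \<alpha>) (at \<alpha> within S)"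
  proof (cases "den C D \<alpha> = 0")
    case True
    have "eventually (\<lambda>\<beta>. crit_ext c A B C D \<beta> < ereal y) (at \<alpha> within S)" for y
    proof -
      \<comment> \<open>Where \<open>den\<close> is positive, the bound
        \<open>c + num / den < y\<close> is equivalent to negativity of this expression, which is
        continuous and equals \<open>num A B \<alpha>\<close> at the zero of
        \<open>den\<close>.\<close>
      have "((\<lambda>\<beta>. num A B \<beta> + (c - y) * den C D \<beta>) \<longlongrightarrow> num A B \<alpha> + (c - y) * den C D \<alpha>)
          (at \<alpha> within S)"
        by (intro tendsto_intros den_lim num_lim)
      moreover have "num A B \<alpha> + (c - y) * den C D \<alpha> < 0"
        using True neg[OF \<alpha>] by simp
      ultimately have "eventually (\<lambda>\<beta>. num A B \<beta> + (c - y) * den C D \<beta> < 0) (at \<alpha> within S)"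
        by (rule order_tendstoD)
      with in_S show ?thesis
      proof eventually_elim
        case (elim \<beta>)
        show ?case
        proof (cases "den C D \<beta> = 0")
          case False
          then have "den C D \<beta> > 0" using nonneg[OF elim(1)] by simp
          then show ?thesis using elim(2) by (simp add: crit_ext_def field_simps)
        qed (simp add: crit_ext_def)
      qed
    qed
    then have "(crit_ext c A B C D \<longlongrightarrow> -\<infinity>) (at \<alpha> within S)"
      by (simp add: tendsto_MInfty)
    then show ?thesis using True by (simp add: crit_ext_def)
  next
    case False
    have "((\<lambda>\<beta>. ereal (c + num A B \<beta> / den C D \<beta>)) \<longlongrightarrow> ereal (c + num A B \<alpha> / den C D \<alpha>))
        (at \<alpha> within S)"
      by (intro tendsto_intros den_lim num_lim False)
    moreover have "eventually (\<lambda>\<beta>. den C D \<beta> \<noteq> 0) (at \<alpha> within S)"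
      using den_lim False by (rule tendsto_imp_eventually_ne)
    then have "eventually (\<lambda>\<beta>. ereal (c + num A B \<beta> / den C D \<beta>) = crit_ext c A B C D \<beta>)
        (at \<alpha> within S)"
      by eventually_elim (simp add: crit_ext_def)
    ultimately have "(crit_ext c A B C D \<longlongrightarrow> ereal (c + num A B \<alpha> / den C D \<alpha>)) (at \<alpha> within S)"
      by (rule Lim_transform_eventually)
    then show ?thesis using False by (simp add: crit_ext_def)
  qed
qed

lemma mono_on_interior_le_right_end:
  fixes g :: "real \<Rightarrow> ereal"
  assumes "l < r" and cont: "continuous_on {l..r} g"
    and mono: "\<And>\<alpha> \<beta>. l < \<alpha> \<Longrightarrow> \<alpha> \<le> \<beta> \<Longrightarrow> \<beta> < r \<Longrightarrow> g \<alpha> \<le> g \<beta>"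
    and \<beta>: "\<beta> \<in> {l..r}"
  shows "g \<beta> \<le> g r"
proof -
  have right: "g \<alpha> \<le> g r" if "l < \<alpha>" "\<alpha> < r" for \<alpha>
  proof (rule tendsto_lowerbound)
    show "(g \<longlongrightarrow> g r) (at_left r)"
      using cont \<open>l < r\<close> continuous_on_Icc_at_leftD by blast
    show "eventually (\<lambda>\<beta>. g \<alpha> \<le> g \<beta>) (at_left r)"
      using eventually_at_left_real[OF \<open>\<alpha> < r\<close>]
      by eventually_elim (use that mono in auto)
  qed simp
  consider "\<beta> = l" | "\<beta> = r" | "l < \<beta>" "\<beta> < r" using \<beta> by fastforce
  then show ?thesis
  proof cases
    case 1
    have "g l \<le> g r"
    proof (rule tendsto_upperbound)
      show "(g \<longlongrightarrow> g l) (at_right l)"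
        using cont \<open>l < r\<close> continuous_on_Icc_at_rightD by blast
      show "eventually (\<lambda>\<beta>. g \<beta> \<le> g r) (at_right l)"
        using eventually_at_right_real[OF \<open>l < r\<close>]
        by eventually_elim (use right in auto)
    qed simp
    then show ?thesis using 1 by simp
  qed (use right in auto)
qed

text \<open>By \<open>slope_pos\<close> the derivative is positive on the open interval; continuity
  carries the monotonicity to the end points.\<close>

lemma crit_ext_le_right_end:
  assumes A: "A > 0" and B: "B \<le> 0" and D: "D \<ge> 0"
    and disc: "0 \<le> B\<^sup>2 - A * (A * D + B * C)"
    and stat: "\<And>s. stationary A B C D = Some s \<Longrightarrow> s \<notin> {l<..<r}"
    and I: "l \<le> 0" "l < r" "\<beta> \<in> {l..r}"
    and den: "\<And>\<alpha>. \<alpha> \<in> {l<..<r} \<Longrightarrow> den C D \<alpha> > 0"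
    and cont: "continuous_on {l..r} (crit_ext c A B C D)"
  shows "crit_ext c A B C D \<beta> \<le> crit_ext c A B C D r"
proof (rule mono_on_interior_le_right_end[OF \<open>l < r\<close> cont _ \<open>\<beta> \<in> {l..r}\<close>])
  fix \<alpha> \<gamma> assume *: "l < \<alpha>" "\<alpha> \<le> \<gamma>" "\<gamma> < r"
  let ?h = "\<lambda>\<alpha>. c + num A B \<alpha> / den C D \<alpha>"
  have "?h \<alpha> \<le> ?h \<gamma>"
  proof (rule DERIV_nonneg_imp_nondecreasing[OF \<open>\<alpha> \<le> \<gamma>\<close>])
    fix x assume "\<alpha> \<le> x" "x \<le> \<gamma>"
    then have x: "x \<in> {l<..<r}" using * by auto
    have pos: "den C D x > 0" by (rule den[OF x])
    have "(num A B has_real_derivative A + 2 * x * B) (at x)"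
      unfolding num_def by (auto intro!: derivative_eq_intros)
    moreover have "(den C D has_real_derivative C - 2 * x * D) (at x)"
      unfolding den_def by (auto intro!: derivative_eq_intros)
    ultimately have "(?h has_real_derivative
        ((A + 2 * x * B) * den C D x - num A B x * (C - 2 * x * D)) / (den C D x * den C D x)) (at x)"
      using pos by (auto intro!: derivative_eq_intros)
    moreover have "(A + 2 * x * B) * den C D x - num A B x * (C - 2 * x * D)
        = A + 2 * B * x + (A * D + B * C) * x\<^sup>2"
      unfolding num_def den_def by algebra
    moreover have "\<dots> > 0" by (rule slope_pos[OF A B D disc stat \<open>l \<le> 0\<close> x pos])
    ultimately show "\<exists>y. (?h has_real_derivative y) (at x) \<and> 0 \<le> y"
      using pos by (metis divide_nonneg_pos less_imp_le mult_pos_pos)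
  qed
  moreover have "den C D \<alpha> > 0" "den C D \<gamma> > 0" using * den by auto
  ultimately show "crit_ext c A B C D \<alpha> \<le> crit_ext c A B C D \<gamma>"
    by (simp add: crit_ext_def)
qed

text \<open>The reflection \<open>\<alpha> \<mapsto> - \<alpha>\<close> turns the left end into a
  right end and makes the coefficient \<open>A\<close> positive.\<close>

lemma crit_ext_le_left_end:
  assumes A: "A < 0" and B: "B \<le> 0" and D: "D \<ge> 0"
    and disc: "0 \<le> B\<^sup>2 - A * (A * D + B * C)"
    and stat: "\<And>s. stationary A B C D = Some s \<Longrightarrow> s \<notin> {l<..<r}"
    and I: "0 \<le> r" "l < r" "\<beta> \<in> {l..r}"
    and den: "\<And>\<alpha>. \<alpha> \<in> {l<..<r} \<Longrightarrow> den C D \<alpha> > 0"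
    and cont: "continuous_on {l..r} (crit_ext c A B C D)"
  shows "crit_ext c A B C D \<beta> \<le> crit_ext c A B C D l"
proof -
  have reflect: "crit_ext c (- A) B (- C) D = (\<lambda>\<alpha>. crit_ext c A B C D (- \<alpha>))"
    using crit_ext_uminus[of c A B C D "- _"] by auto
  have "continuous_on {- r..- l} (\<lambda>\<alpha>. crit_ext c A B C D (- \<alpha>))"
    by (rule continuous_on_compose2[OF cont]) (auto intro: continuous_intros)
  moreover have "0 \<le> B\<^sup>2 - (- A) * ((- A) * D + B * (- C))"
    using disc by (simp add: algebra_simps)
  moreover have "den (- C) D \<alpha> > 0" if "\<alpha> \<in> {- r<..<- l}" for \<alpha>
    using den[of "- \<alpha>"] that by (simp add: den_def)
  moreover have "s \<notin> {- r<..<- l}" if "stationary (- A) B (- C) D = Some s" for s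
    using stat[of "- s"] that by (auto simp: stationary_uminus)
  ultimately have "crit_ext c (- A) B (- C) D (- \<beta>) \<le> crit_ext c (- A) B (- C) D (- l)"
    using A B D I
    by (intro crit_ext_le_right_end[where l = "- r"]) (simp_all add: reflect)
  then show ?thesis by (simp add: crit_ext_uminus)
qed

lemma crit_ext_le_zero:
  assumes "A = 0" "B \<le> 0" "den C D \<beta> \<ge> 0"
  shows "crit_ext c A B C D \<beta> \<le> crit_ext c A B C D 0"
proof -
  \<comment> \<open>If \<open>den\<close> vanishes, the quotient is 0 by convention and
    \<open>crit_ext\<close> is \<open>-\<infinity>\<close>.\<close>
  have "\<beta>\<^sup>2 * B / den C D \<beta> \<le> 0"
    using assms by (intro divide_nonpos_nonneg mult_nonneg_nonpos) auto
  then show ?thesis using assms by (simp add: crit_ext_def num_def den_def)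
qed


section \<open>Rank-one matrices and the inverse of the shifted matrix\<close>

lemma outer_mult_vec: "outer y *v x = (y \<bullet> x) *\<^sub>R y"
  by (simp add: outer_def vec_eq_iff matrix_matrix_mult_def matrix_vector_mult_def
      columnvector_def rowvector_def inner_vec_def sum_distrib_left mult_ac)

text \<open>Unlike \<open>outer\<close>, this allows two different vectors, as the mixed terms of
  the inverse require.\<close>

definition rank_one :: "real^'m \<Rightarrow> real^'m \<Rightarrow> real^'m^'m" where
  "rank_one a b = (\<chi> i j. a $ i * b $ j)"

lemma rank_one_mult_vec: "rank_one a b *v x = (b \<bullet> x) *\<^sub>R a"
  by (simp add: rank_one_def vec_eq_iff matrix_vector_mult_def inner_vec_def
      sum_distrib_left mult_ac)

lemma trace_rank_one: "trace (rank_one a b) = a \<bullet> b"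
  by (simp add: rank_one_def trace_def inner_vec_def)

lemma trace_scaleR: "trace (k *\<^sub>R A) = k * trace A" for A :: "real^'m^'m"
  by (simp add: trace_def sum_distrib_left)

text \<open>A right inverse of a square matrix is two-sided; it witnesses the choice in
  \<open>matrix_inv\<close>, and inverses are unique.\<close>

lemma matrix_inv_eqI:
  fixes A X :: "real^'m^'m"
  assumes "A ** X = mat 1"
  shows "matrix_inv A = X"
proof -
  have XA: "X ** A = mat 1" using assms matrix_left_right_inverse by blast
  have "A ** matrix_inv A = mat 1 \<and> matrix_inv A ** A = mat 1"
    unfolding matrix_inv_def by (rule someI[of _ X]) (use assms XA in auto)
  then show ?thesis
    by (metis XA matrix_mul_assoc matrix_mul_lid matrix_mul_rid)
qed

text \<open>The coefficients of the inverse come from Woodbury's identity.\<close>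

lemma trace_inv_exchange:
  fixes M V :: "real^'m^'m" and y z :: "real^'m"
  assumes MV: "M ** V = mat 1" and sym: "\<And>a b. a \<bullet> (V *v b) = (V *v a) \<bullet> b"
  defines "p \<equiv> V *v y" and "q \<equiv> V *v z"
  defines "C \<equiv> z \<bullet> q - y \<bullet> p" and "D \<equiv> (y \<bullet> p) * (z \<bullet> q) - (y \<bullet> q)\<^sup>2"
  assumes den: "den C D \<alpha> \<noteq> 0"
  shows "trace (matrix_inv (M + \<alpha> *\<^sub>R outer z - \<alpha> *\<^sub>R outer y)) = trace V
    - num (q \<bullet> q - p \<bullet> p)
        (2 * (y \<bullet> q) * (p \<bullet> q) - (y \<bullet> p) * (q \<bullet> q) - (z \<bullet> q) * (p \<bullet> p)) \<alpha> / den C D \<alpha>"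
proof -
  define \<delta> where "\<delta> = den C D \<alpha>"
  define a where "a = y \<bullet> p"
  define b where "b = z \<bullet> q"
  define g where "g = y \<bullet> q"
  have zp: "z \<bullet> p = g"
    unfolding g_def p_def q_def using sym[of z y] by (simp add: inner_commute)
  \<comment> \<open>For \<open>\<alpha> \<noteq> 0\<close> these are the entries of minus the
    inverse of the symmetric 2 by 2 matrix with diagonal \<open>a - 1 / \<alpha>\<close>,
    \<open>b + 1 / \<alpha>\<close> and off-diagonal entry \<open>g\<close>. In this form they also
    cover \<open>\<alpha> = 0\<close>.\<close>
  define k1 where "k1 = \<alpha> * (1 + \<alpha> * b) / \<delta>"
  define k2 where "k2 = - (\<alpha>\<^sup>2 * g) / \<delta>"
  define k3 where "k3 = \<alpha> * (\<alpha> * a - 1) / \<delta>"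
  have \<delta>: "\<delta> \<noteq> 0" "\<delta> = 1 + \<alpha> * (b - a) - \<alpha>\<^sup>2 * (a * b - g\<^sup>2)"
    using den by (simp_all add: \<delta>_def den_def C_def D_def a_def b_def g_def)
  have k: "\<delta> * k1 = \<alpha> * (1 + \<alpha> * b)" "\<delta> * k2 = - (\<alpha>\<^sup>2 * g)" "\<delta> * k3 = \<alpha> * (\<alpha> * a - 1)"
    using \<delta>(1) by (simp_all add: k1_def k2_def k3_def)
  define X where "X = V + k1 *\<^sub>R rank_one p p + k2 *\<^sub>R (rank_one p q + rank_one q p)
    + k3 *\<^sub>R rank_one q q"
  have MVx: "M *v (V *v x) = x" for x
    by (simp add: matrix_vector_mul_assoc MV)
  have "(M + \<alpha> *\<^sub>R outer z - \<alpha> *\<^sub>R outer y) *v (X *v x) = x" for x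
  proof -
    define s where "s = p \<bullet> x"
    define t where "t = q \<bullet> x"
    define c1 where "c1 = k1 * s + k2 * t"
    define c2 where "c2 = k2 * s + k3 * t"
    have Xx: "X *v x = V *v x + c1 *\<^sub>R p + c2 *\<^sub>R q"
      by (simp add: X_def c1_def c2_def s_def t_def matrix_vector_mult_add_rdistrib
          scaleR_matrix_vector_assoc[symmetric] rank_one_mult_vec algebra_simps)
    have yX: "y \<bullet> (X *v x) = s + c1 * a + c2 * g"
      using sym[of y x] by (simp add: Xx inner_add_right s_def p_def[symmetric] a_def g_def)
    have zX: "z \<bullet> (X *v x) = t + c1 * g + c2 * b"
      using sym[of z x] by (simp add: Xx inner_add_right t_def q_def[symmetric] b_def zp)
    have c: "\<delta> * c1 = \<alpha> * (1 + \<alpha> * b) * s - \<alpha>\<^sup>2 * g * t"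
      "\<delta> * c2 = - (\<alpha>\<^sup>2 * g * s) + \<alpha> * (\<alpha> * a - 1) * t"
      unfolding c1_def c2_def using k by algebra+
    \<comment> \<open>These two equations say that the rank-one updates cancel the surplus
      \<open>c1 *\<^sub>R y + c2 *\<^sub>R z\<close> in \<open>M *v (X *v x)\<close>.\<close>
    have "\<delta> * (c1 - \<alpha> * (s + c1 * a + c2 * g)) = 0" "\<delta> * (c2 + \<alpha> * (t + c1 * g + c2 * b)) = 0"
      using c \<delta>(2) by algebra+
    then have 0: "c1 = \<alpha> * (s + c1 * a + c2 * g)" "c2 = - (\<alpha> * (t + c1 * g + c2 * b))"
      using \<delta>(1) by auto
    have "(M + \<alpha> *\<^sub>R outer z - \<alpha> *\<^sub>R outer y) *v (X *v x)
      = M *v (X *v x) + (\<alpha> * (z \<bullet> (X *v x))) *\<^sub>R z - (\<alpha> * (y \<bullet> (X *v x))) *\<^sub>R y"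
      by (simp add: matrix_vector_mult_add_rdistrib matrix_vector_mult_diff_rdistrib
          scaleR_matrix_vector_assoc[symmetric] outer_mult_vec)
    also have "M *v (X *v x) = x + c1 *\<^sub>R y + c2 *\<^sub>R z"
      by (simp add: Xx matrix_vector_right_distrib matrix_vector_mult_scaleR p_def q_def MVx)
    also have "\<alpha> * (z \<bullet> (X *v x)) = - c2" using 0(2) zX by simp
    also have "\<alpha> * (y \<bullet> (X *v x)) = c1" using 0(1) yX by simp
    finally show ?thesis by simp
  qed
  then have "(M + \<alpha> *\<^sub>R outer z - \<alpha> *\<^sub>R outer y) ** X = mat 1"
    by (simp add: matrix_eq matrix_vector_mul_assoc[symmetric])
  then have "trace (matrix_inv (M + \<alpha> *\<^sub>R outer z - \<alpha> *\<^sub>R outer y)) = trace X"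
    by (simp add: matrix_inv_eqI)
  also have "\<dots> = trace V + (k1 * (p \<bullet> p) + 2 * k2 * (p \<bullet> q) + k3 * (q \<bullet> q))"
    by (simp add: X_def trace_add trace_scaleR trace_rank_one inner_commute algebra_simps)
  also have "k1 * (p \<bullet> p) + 2 * k2 * (p \<bullet> q) + k3 * (q \<bullet> q) =
      - num (q \<bullet> q - p \<bullet> p) (2 * g * (p \<bullet> q) - a * (q \<bullet> q) - b * (p \<bullet> p)) \<alpha> / \<delta>"
    using \<delta>(1) by (simp add: k1_def k2_def k3_def num_def field_simps power2_eq_square)
  finally show ?thesis by (simp add: \<delta>_def a_def b_def g_def)
qed

section \<open>The information matrix, its inverse, and Gram inequalities\<close>

lemma info_matrix_mult_vec: "info_matrix f w *v x = (\<Sum>z\<in>UNIV. (w $ z * (f z \<bullet> x)) *\<^sub>R f z)"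
proof -
  have "(\<Sum>z\<in>S. w $ z *\<^sub>R outer (f z)) *v x = (\<Sum>z\<in>S. (w $ z * (f z \<bullet> x)) *\<^sub>R f z)"
    if "finite S" for S
    using that by induction
      (simp_all add: matrix_vector_mult_add_rdistrib scaleR_matrix_vector_assoc[symmetric]
        outer_mult_vec)
  then show ?thesis by (simp add: info_matrix_def)
qed

lemma info_matrix_bilinear:
  "x \<bullet> (info_matrix f w *v y) = (\<Sum>z\<in>UNIV. w $ z * (f z \<bullet> x) * (f z \<bullet> y))"
  by (simp add: info_matrix_mult_vec inner_sum_right inner_commute mult_ac)

context
  fixes f :: "'n::finite \<Rightarrow> real^'m" and w :: "real^'n"
  assumes w: "w \<in> regular_designs f"
begin

lemma weight_nonneg: "w $ z \<ge> 0"
  using w by (simp add: regular_designs_def designs_def)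

lemma info_var_inverse: "info_matrix f w ** var_matrix f w = mat 1"
proof -
  obtain X where "info_matrix f w ** X = mat 1"
    using w by (auto simp: regular_designs_def invertible_def)
  then show ?thesis by (simp add: var_matrix_def matrix_inv_eqI)
qed

lemma info_var_cancel: "info_matrix f w *v (var_matrix f w *v x) = x"
  by (simp add: matrix_vector_mul_assoc info_var_inverse)

text \<open>Writing both vectors as \<open>M V x\<close> and \<open>M V y\<close> reduces the claim
  to the symmetry of \<open>M\<close>.\<close>

lemma var_matrix_symmetric: "x \<bullet> (var_matrix f w *v y) = (var_matrix f w *v x) \<bullet> y"
proof -
  have "x \<bullet> (var_matrix f w *v y) =
      (var_matrix f w *v y) \<bullet> (info_matrix f w *v (var_matrix f w *v x))"
    by (simp add: info_var_cancel inner_commute)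
  also have "\<dots> = (var_matrix f w *v x) \<bullet> (info_matrix f w *v (var_matrix f w *v y))"
    by (simp add: info_matrix_bilinear mult_ac)
  finally show ?thesis by (simp add: info_var_cancel)
qed

lemma a_cov_eq_inner: "a_cov f w x y = (var_matrix f w *v f x) \<bullet> (var_matrix f w *v f y)"
  by (simp add: a_cov_def matrix_vector_mul_assoc[symmetric] var_matrix_symmetric)

text \<open>Since \<open>V = V M V\<close>, the inner products of these vectors are the numbers
  \<open>d_cov\<close>; they serve in place of a matrix square root of \<open>V\<close>.\<close>

definition weighted_fit :: "'n \<Rightarrow> real^'n" where
  "weighted_fit x = (\<chi> z. sqrt (w $ z) * (f z \<bullet> (var_matrix f w *v f x)))"

lemma d_cov_eq_inner: "d_cov f w x y = weighted_fit x \<bullet> weighted_fit y"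
proof -
  have "d_cov f w x y = (var_matrix f w *v f x) \<bullet> (info_matrix f w *v (var_matrix f w *v f y))"
    by (simp add: d_cov_def var_matrix_symmetric info_var_cancel)
  also have "\<dots> = (\<Sum>z\<in>UNIV. (sqrt (w $ z))\<^sup>2 * (f z \<bullet> (var_matrix f w *v f x))
      * (f z \<bullet> (var_matrix f w *v f y)))"
    by (simp add: info_matrix_bilinear weight_nonneg)
  also have "\<dots> = (\<Sum>z\<in>UNIV. weighted_fit x $ z * weighted_fit y $ z)"
    by (simp only: weighted_fit_def vec_lambda_beta power2_eq_square mult_ac)
  also have "\<dots> = weighted_fit x \<bullet> weighted_fit y"
    by (simp add: inner_vec_def)
  finally show ?thesis .
qed

lemma d_cov_nonneg: "d_cov f w x x \<ge> 0"
  by (simp add: d_cov_eq_inner)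

lemma d_cov_Cauchy_Schwarz: "(d_cov f w x y)\<^sup>2 \<le> d_cov f w x x * d_cov f w y y"
  by (simp add: d_cov_eq_inner Cauchy_Schwarz_ineq)

lemma a_cov_nonneg: "a_cov f w x x \<ge> 0"
  by (simp add: a_cov_eq_inner)

lemma a_cov_pos: "f x \<noteq> 0 \<Longrightarrow> a_cov f w x x > 0"
  using info_var_cancel[of "f x"] by (auto simp: a_cov_eq_inner)

lemma a_cov_Cauchy_Schwarz: "(a_cov f w x y)\<^sup>2 \<le> a_cov f w x x * a_cov f w y y"
  by (simp add: a_cov_eq_inner Cauchy_Schwarz_ineq)

text \<open>The coordinate \<open>x\<close> alone contributes
  \<open>w $ x * (d_cov f w x x)\<^sup>2\<close> to the squared norm of
  \<open>weighted_fit x\<close>, which is \<open>d_cov f w x x\<close>.\<close>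

lemma weight_d_cov_le_1: "w $ x * d_cov f w x x \<le> 1"
proof (cases "d_cov f w x x = 0")
  case False
  then have pos: "d_cov f w x x > 0" using d_cov_nonneg[of x] by simp
  have "w $ x * (d_cov f w x x)\<^sup>2 = (weighted_fit x $ x)\<^sup>2"
    by (simp add: weighted_fit_def d_cov_def power_mult_distrib weight_nonneg)
  also have "\<dots> \<le> (\<Sum>z\<in>UNIV. (weighted_fit x $ z)\<^sup>2)"
    by (rule member_le_sum) auto
  also have "\<dots> = d_cov f w x x"
    by (simp add: d_cov_eq_inner inner_vec_def power2_eq_square)
  finally have "(w $ x * d_cov f w x x) * d_cov f w x x \<le> 1 * d_cov f w x x"
    by (simp add: power2_eq_square mult_ac)
  then show ?thesis using pos by (rule mult_right_le_imp_le)
qed simp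

lemma coef_D_nonneg: "coef_D f w u v \<ge> 0"
  using d_cov_Cauchy_Schwarz by (simp add: coef_D_def)

text \<open>Cauchy-Schwarz for both Gram matrices, followed by the inequality of arithmetic and
  geometric means for \<open>?du * ?av\<close> and \<open>?dv * ?au\<close>.\<close>

lemma coef_B_nonpos: "coef_B f w u v \<le> 0"
proof -
  let ?du = "d_cov f w u u" and ?dv = "d_cov f w v v"
  let ?au = "a_cov f w u u" and ?av = "a_cov f w v v"
  have "(2 * (d_cov f w u v * a_cov f w u v))\<^sup>2 = 4 * ((d_cov f w u v)\<^sup>2 * (a_cov f w u v)\<^sup>2)"
    by (simp add: power_mult_distrib)
  also have "\<dots> \<le> 4 * ((?du * ?dv) * (?au * ?av))"
    using d_cov_Cauchy_Schwarz[of u v] a_cov_Cauchy_Schwarz[of u v] d_cov_nonneg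
    by (intro mult_left_mono mult_mono) auto
  also have "\<dots> = (?du * ?av + ?dv * ?au)\<^sup>2 - (?du * ?av - ?dv * ?au)\<^sup>2"
    by algebra
  also have "\<dots> \<le> (?du * ?av + ?dv * ?au)\<^sup>2" by simp
  finally have "2 * (d_cov f w u v * a_cov f w u v) \<le> ?du * ?av + ?dv * ?au"
    by (rule power2_le_imp_le) (simp add: d_cov_nonneg a_cov_nonneg)
  then show ?thesis by (simp add: coef_B_def)
qed

text \<open>The expression is a product of two factors that are nonnegative by Cauchy-Schwarz, plus
  a square.\<close>

lemma discriminant_nonneg:
  "0 \<le> (coef_B f w u v)\<^sup>2 - coef_A f w u v *
     (coef_A f w u v * coef_D f w u v + coef_B f w u v * coef_C f w u v)"
proof -
  let ?du = "d_cov f w u u" and ?dv = "d_cov f w v v" and ?d = "d_cov f w u v"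
  let ?au = "a_cov f w u u" and ?av = "a_cov f w v v" and ?a = "a_cov f w u v"
  have "(?du + ?dv)\<^sup>2 - 4 * ?d\<^sup>2 = (?du - ?dv)\<^sup>2 + 4 * (?du * ?dv - ?d\<^sup>2)" by algebra
  also have "\<dots> \<ge> 0" using d_cov_Cauchy_Schwarz[of u v] by simp
  finally have "0 \<le> ((?du + ?dv)\<^sup>2 - 4 * ?d\<^sup>2) * (?au * ?av - ?a\<^sup>2)
      + ((?du + ?dv) * ?a - ?d * (?au + ?av))\<^sup>2"
    using a_cov_Cauchy_Schwarz[of u v] by simp
  also have "\<dots> = (coef_B f w u v)\<^sup>2 - coef_A f w u v *
     (coef_A f w u v * coef_D f w u v + coef_B f w u v * coef_C f w u v)"
    unfolding coef_A_def coef_B_def coef_C_def coef_D_def by algebra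
  finally show ?thesis .
qed

section \<open>Signs of denominator and numerator on the interval\<close>

lemma den_eq:
  "den (coef_C f w u v) (coef_D f w u v) \<alpha> =
     (1 - \<alpha> * d_cov f w u u) * (1 + \<alpha> * d_cov f w v v) + (\<alpha> * d_cov f w u v)\<^sup>2"
  unfolding den_def coef_C_def coef_D_def by algebra

text \<open>The bound \<open>weight_d_cov_le_1\<close> controls each factor of \<open>den_eq\<close>
  up to the end points; the remaining summand there is a square.\<close>

lemma den_factors:
  assumes "\<alpha> \<in> {- (w $ v)..w $ u}"
  shows "1 - \<alpha> * d_cov f w u u \<ge> 0" "1 + \<alpha> * d_cov f w v v \<ge> 0"
proof -
  have "\<alpha> * d_cov f w u u \<le> w $ u * d_cov f w u u"
    using assms d_cov_nonneg by (intro mult_right_mono) auto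
  then show "1 - \<alpha> * d_cov f w u u \<ge> 0" using weight_d_cov_le_1[of u] by simp
  have "(- \<alpha>) * d_cov f w v v \<le> w $ v * d_cov f w v v"
    using assms d_cov_nonneg by (intro mult_right_mono) auto
  then show "1 + \<alpha> * d_cov f w v v \<ge> 0" using weight_d_cov_le_1[of v] by simp
qed

lemma den_nonneg:
  "\<alpha> \<in> {- (w $ v)..w $ u} \<Longrightarrow> den (coef_C f w u v) (coef_D f w u v) \<alpha> \<ge> 0"
  using den_factors[of \<alpha> v u] by (simp add: den_eq)

lemma den_pos:
  assumes "\<alpha> \<in> {- (w $ v)<..<w $ u}"
  shows "den (coef_C f w u v) (coef_D f w u v) \<alpha> > 0"
proof -
  have "\<alpha> * d_cov f w u u < 1"
  proof (cases "d_cov f w u u = 0")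
    case False
    then have "\<alpha> * d_cov f w u u < w $ u * d_cov f w u u"
      using assms d_cov_nonneg[of u] by (intro mult_strict_right_mono) auto
    then show ?thesis using weight_d_cov_le_1[of u] by simp
  qed simp
  moreover have "(- \<alpha>) * d_cov f w v v < 1"
  proof (cases "d_cov f w v v = 0")
    case False
    then have "(- \<alpha>) * d_cov f w v v < w $ v * d_cov f w v v"
      using assms d_cov_nonneg[of v] by (intro mult_strict_right_mono) auto
    then show ?thesis using weight_d_cov_le_1[of v] by simp
  qed simp
  ultimately have "(1 - \<alpha> * d_cov f w u u) * (1 + \<alpha> * d_cov f w v v) > 0"
    by (intro mult_pos_pos) auto
  then show ?thesis unfolding den_eq by (rule add_pos_nonneg) simp
qed

text \<open>Both summands in \<open>den_eq\<close> must vanish, so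
  \<open>\<alpha> \<noteq> 0\<close> and \<open>d_cov f w u v = 0\<close>. Then \<open>num\<close>
  factorises, one of its two terms disappears, and the other is strict by
  \<open>a_cov_pos\<close>.\<close>

lemma num_neg:
  assumes "f u \<noteq> 0" "f v \<noteq> 0" and \<alpha>: "\<alpha> \<in> {- (w $ v)..w $ u}"
    and "den (coef_C f w u v) (coef_D f w u v) \<alpha> = 0"
  shows "num (coef_A f w u v) (coef_B f w u v) \<alpha> < 0"
proof -
  let ?du = "d_cov f w u u" and ?dv = "d_cov f w v v" and ?d = "d_cov f w u v"
  let ?au = "a_cov f w u u" and ?av = "a_cov f w v v"
  have "(1 - \<alpha> * ?du) * (1 + \<alpha> * ?dv) \<ge> 0"
    using den_factors[OF \<alpha>] by simp
  then have zero: "(1 - \<alpha> * ?du) * (1 + \<alpha> * ?dv) = 0" "(\<alpha> * ?d)\<^sup>2 = 0"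
    using assms(4) unfolding den_eq by (simp_all add: add_nonneg_eq_0_iff)
  then have "\<alpha> \<noteq> 0" "?d = 0" by auto
  then have num: "num (coef_A f w u v) (coef_B f w u v) \<alpha> =
      \<alpha> * (?av * (1 - \<alpha> * ?du) - ?au * (1 + \<alpha> * ?dv))"
    unfolding num_def coef_A_def coef_B_def by algebra
  show ?thesis
  proof (cases "\<alpha> > 0")
    case True
    then have "\<alpha> * ?dv \<ge> 0" using d_cov_nonneg by simp
    then have *: "1 + \<alpha> * ?dv > 0" by linarith
    with zero(1) have "1 - \<alpha> * ?du = 0" by auto
    moreover have "\<alpha> * (?au * (1 + \<alpha> * ?dv)) > 0"
      using * True a_cov_pos[OF assms(1)] by (intro mult_pos_pos)
    ultimately show ?thesis unfolding num by simp
  next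
    case False
    with \<open>\<alpha> \<noteq> 0\<close> have "\<alpha> < 0" by simp
    then have "\<alpha> * ?du \<le> 0" using d_cov_nonneg by (simp add: mult_nonpos_nonneg)
    then have *: "1 - \<alpha> * ?du > 0" by linarith
    with zero(1) have "1 + \<alpha> * ?dv = 0" by auto
    moreover have "\<alpha> * (?av * (1 - \<alpha> * ?du)) < 0"
      using * \<open>\<alpha> < 0\<close> a_cov_pos[OF assms(2)] by (intro mult_neg_pos mult_pos_pos)
    ultimately show ?thesis unfolding num by simp
  qed
qed

section \<open>Identification of \<open>hbar\<close> with the rational expression\<close>

lemma h_crit_eq:
  assumes "den (coef_C f w u v) (coef_D f w u v) \<alpha> \<noteq> 0"
  shows "h_crit f w u v \<alpha> = - trace (var_matrix f w) +
    num (coef_A f w u v) (coef_B f w u v) \<alpha> / den (coef_C f w u v) (coef_D f w u v) \<alpha>"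
  using trace_inv_exchange[OF info_var_inverse var_matrix_symmetric, of "f v" "f u" \<alpha>] assms
  by (simp add: h_crit_def M_shift_def coef_A_def coef_B_def coef_C_def coef_D_def
      a_cov_eq_inner d_cov_def)

abbreviation crit_bar :: "'n \<Rightarrow> 'n \<Rightarrow> real \<Rightarrow> ereal" where
  "crit_bar u v \<equiv> crit_ext (- trace (var_matrix f w))
     (coef_A f w u v) (coef_B f w u v) (coef_C f w u v) (coef_D f w u v)"

lemma continuous_on_crit_bar:
  assumes "f u \<noteq> 0" "f v \<noteq> 0"
  shows "continuous_on {- (w $ v)..w $ u} (crit_bar u v)"
  by (rule continuous_on_crit_ext) (simp_all add: den_nonneg num_neg assms del: atLeastAtMost_iff)

lemma hbar_eq:
  assumes "f u \<noteq> 0" "f v \<noteq> 0" "- (w $ v) < w $ u" "\<alpha> \<in> {- (w $ v)..w $ u}"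
  shows "hbar f w u v \<alpha> = crit_bar u v \<alpha>"
proof (rule hbar_is_the_continuous_extension[OF assms(3) _ _ assms(4)])
  show "continuous_on {- (w $ v)..w $ u} (crit_bar u v)"
    by (rule continuous_on_crit_bar[OF assms(1,2)])
  show "crit_bar u v \<beta> = ereal (h_crit f w u v \<beta>)" if "\<beta> \<in> {- (w $ v)<..<w $ u}" for \<beta>
    using den_pos[OF that] by (simp add: crit_ext_def h_crit_eq)
qed

end

theorem proposition1:
  fixes f :: "'n::finite \<Rightarrow> real^'m"
    and w :: "real^'n"
    and u v :: 'n
  assumes "\<forall>x. f x \<noteq> 0"
    and "span (range f) = UNIV"
    and "w \<in> regular_designs f"
    and "w $ u > 0 \<or> w $ v > 0"
  shows "(\<forall>\<alpha>. alpha_s f w u v = Some \<alpha> \<and> \<alpha> \<in> {- (w $ v)<..<w $ u} \<longrightarrow>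
            is_arg_max (hbar f w u v) (\<lambda>\<beta>. \<beta> \<in> {- (w $ v)..w $ u}) \<alpha>) \<and>
         (coef_A f w u v * coef_D f w u v = - (coef_B f w u v * coef_C f w u v)
              \<and> coef_B f w u v = 0
            \<or> (\<exists>\<alpha>. alpha_s f w u v = Some \<alpha> \<and> \<alpha> \<notin> {- (w $ v)<..<w $ u}) \<longrightarrow>
            is_arg_max (hbar f w u v) (\<lambda>\<beta>. \<beta> \<in> {- (w $ v)..w $ u}) (alpha_n f w u v))"
proof -
  let ?I = "{- (w $ v)<..<w $ u}" and ?J = "{- (w $ v)..w $ u}"
  let ?c = "- trace (var_matrix f w)"
  let ?A = "coef_A f w u v" and ?B = "coef_B f w u v"
  let ?C = "coef_C f w u v" and ?D = "coef_D f w u v"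
  let ?g = "crit_ext ?c ?A ?B ?C ?D"
  note w = assms(3)
  have ends: "- (w $ v) \<le> 0" "0 \<le> w $ u" "- (w $ v) < w $ u"
    using weight_nonneg[OF w, of u] weight_nonneg[OF w, of v] assms(4) by auto
  have f: "f u \<noteq> 0" "f v \<noteq> 0" using assms(1) by auto
  \<comment> \<open>From here on \<open>hbar\<close> is replaced by the rational expression, and
    maximality is a plain comparison in a linear order.\<close>
  have arg_max: "is_arg_max (hbar f w u v) (\<lambda>\<beta>. \<beta> \<in> ?J) \<alpha>"
    if "\<alpha> \<in> ?J" "\<And>\<beta>. \<beta> \<in> ?J \<Longrightarrow> ?g \<beta> \<le> ?g \<alpha>" for \<alpha>
    using that by (simp add: is_arg_max_linorder hbar_eq[OF w f ends(3)])
  note B = coef_B_nonpos[OF w, of u v] and D = coef_D_nonneg[OF w, of u v]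
    and disc = discriminant_nonneg[OF w, of u v]
    and den_pos = den_pos[OF w, of _ v u]
    and cont = continuous_on_crit_bar[OF w f]
  have "is_arg_max (hbar f w u v) (\<lambda>\<beta>. \<beta> \<in> ?J) \<alpha>"
    if "alpha_s f w u v = Some \<alpha>" "\<alpha> \<in> ?I" for \<alpha>
    using that
    by (intro arg_max crit_ext_le_stationary[OF B disc])
      (auto simp: alpha_s_def intro: den_pos den_nonneg[OF w])
  moreover have "is_arg_max (hbar f w u v) (\<lambda>\<beta>. \<beta> \<in> ?J) (alpha_n f w u v)"
    if cases: "?A * ?D = - (?B * ?C) \<and> ?B = 0 \<or> (\<exists>\<alpha>. alpha_s f w u v = Some \<alpha> \<and> \<alpha> \<notin> ?I)"
  proof (rule arg_max)
    \<comment> \<open>In the first alternative \<open>stationary\<close> is \<open>None\<close>; in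
      the second its only value is outside the open interval.\<close>
    have stat: "s \<notin> ?I" if "stationary ?A ?B ?C ?D = Some s" for s
      using that cases by (auto simp: alpha_s_def stationary_def)
    show "alpha_n f w u v \<in> ?J" using ends by (simp add: alpha_n_def)
    show "?g \<beta> \<le> ?g (alpha_n f w u v)" if \<beta>: "\<beta> \<in> ?J" for \<beta>
    proof (cases ?A "0 :: real" rule: linorder_cases)
      case less
      then show ?thesis
        using crit_ext_le_left_end[OF less B D disc stat ends(2,3) \<beta> den_pos cont]
        by (simp add: alpha_n_def)
    next
      case equal
      then show ?thesis
        using crit_ext_le_zero[OF equal B den_nonneg[OF w \<beta>]] by (simp add: alpha_n_def)
    next
      case greater
      then show ?thesis
        using crit_ext_le_right_end[OF greater B D disc stat ends(1,3) \<beta> den_pos cont]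
        by (simp add: alpha_n_def)
    qed
  qed
  ultimately show ?thesis by blast
qed

end
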